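(* Let $(\alpha,\beta)\in\mathfrak{m}^*\times\mathfrak{m}^*_{\mathbb{C}}$ be a regular value of the hyperkähler moment map $\mu=(\mu_{\mathbb{R}},\mu_{\mathbb{C}})$, with $\{u_i\}_{i=1}^d$ regular (so that the toric hyperkähler variety $Y(\alpha,\beta)=\mu^{-1}(\alpha,\beta)/M$ is a smooth manifold), and let $\mathcal{A}=\{(H_i,u_i)\}_{i=1}^d$ be the oriented hyperplane arrangement in $\mathfrak{n}^*$ determined by a lift $\lambda$ of $\alpha$. Then a point $(z,w)\in\mu_{\mathbb{C}}^{-1}(\beta)$ is $\alpha$-semi-stable if and only if $St_{\mathcal{A}}(z,w)\subset\mathfrak{n}^*$ is nonempty.
   Context: Let $T^d$ be the real $d$-torus with Lie algebra $\mathfrak{t}\cong\mathbb{R}^d$, standard basis $e_1,\dots,e_d$ and dual basis $e_1^*,\dots,e_d^*$. Let $M\subset T^d$ be a connected $m$-dimensional subtorus with Lie algebra $\mathfrak{m}$, $N=T^d/M$ with Lie algebra $\mathfrak{n}=\mathfrak{t}/\mathfrak{m}$ of dimension $n=d-m$. There are exact sequences $0\to\mathfrak{m}\xrightarrow{\iota}\mathfrak{t}\xrightarrow{\pi}\mathfrak{n}\to0$ and $0\to\mathfrak{n}^*\xrightarrow{\pi^*}\mathfrak{t}^*\xrightarrow{\iota^*}\mathfrak{m}^*\to0$. Put $u_i=\pi(e_i)$, assumed to be primitive vectors of the lattice $\mathfrak{n}_{\mathbb{Z}}=\pi(\mathbb{Z}^d)$. $\{u_i\}$ is regular if every $n$ linearly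 independent vectors among the $u_i$ form a $\mathbb{Z}$-basis of $\mathfrak{n}_{\mathbb{Z}}$. $T^d$ acts on $\mathbb{H}^d\cong T^*\mathbb{C}^d\cong\mathbb{C}^d\times\mathbb{C}^d$ by $(z,w)\zeta=(z\zeta,w\zeta^{-1})$. The subtorus $M$ has hyperkähler moment map $\mu=(\mu_{\mathbb{R}},\mu_{\mathbb{C}}):\mathbb{H}^d\to\mathfrak{m}^*\times\mathfrak{m}^*_{\mathbb{C}}$, $\mu_{\mathbb{R}}(z,w)=\frac12\sum_i(|z_i|^2-|w_i|^2)\iota^*e_i^*$, $\mu_{\mathbb{C}}(z,w)=\sum_iz_iw_i\,\iota^*e_i^*$. A lift of $\alpha\in\mathfrak{m}^*$ is $\lambda\in\mathbb{R}^d$ with $\alpha=\sum_i\lambda_i\iota^*e_i^*$. It defines $H_i=\{x\in\mathfrak{n}^*\mid\langle u_i,x\rangle+\lambda_i=0\}$, $H_i^{\ge0}=\{x\mid\langle u_i,x\rangle+\lambda_i\ge0\}$, $H_i^{\le0}=\{x\mid\langle u_i,x\rangle+\lambda_i\le0\}$. (Different lifts give arrangements differing by a translation.) For $(z,w)\in\mathbb{H}^d$ set $F_z(i)=H_i^{\ge0}$ if $z_i\neq0$, $F_z(i)=H_i$ if $z_i=0$; $F_w(i)=H_i^{\le0}$ if $w_i\ne0$, $F_w(i)=H_i$ if $w_i=0$; and $St_{\mathcal{A}}(z,w)=\bigcap_{i=1}^d\big(F_z(i)\cup F_w(i)\big)$. Semi-stability: for $\alpha\in\mathfrak{m}^*$,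 a point $(z,w)\in\mu_{\mathbb{C}}^{-1}(\beta)$ is $\alpha$-semi-stable if $\alpha\in\sum_{i=1}^d\mathbb{R}_{\ge0}|z_i|^2\,\iota^*e_i^*+\sum_{i=1}^d\mathbb{R}_{\ge0}|w_i|^2(-\iota^*e_i^* )$. (For integral $\alpha$ this is equivalent to GIT semi-stability for the action of the complexified torus $M_{\mathbb{C}}$ on $\mu_{\mathbb{C}}^{-1}(\beta)$, linearized on the trivial line bundle by the character induced by $\alpha$.) *)

theory Defs
  imports "HOL-Analysis.Analysis"
begin

subsection \<open>Subtori of the real torus and their Lie algebras\<close>

text \<open>The real torus is realised inside \<open>\<complex>\<^sup>d\<close>, with componentwise multiplication.
  Its closed connected subgroups are exactly its (connected) subtori.\<close>

definition torus :: "(complex ^ 'd) set" where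
  "torus = {t. \<forall>i. norm (t $ i) = 1}"

definition torus_exp :: "real ^ 'd \<Rightarrow> complex ^ 'd" where
  "torus_exp v = (\<chi> i. cis (2 * pi * v $ i))"

definition subtorus :: "(complex ^ 'd) set \<Rightarrow> bool" where
  "subtorus M \<longleftrightarrow> M \<subseteq> torus \<and> 1 \<in> M \<and> (\<forall>s\<in>M. \<forall>t\<in>M. s * t \<in> M)
     \<and> (\<forall>s\<in>M. (\<chi> i. inverse (s $ i)) \<in> M) \<and> closed M \<and> connected M"

definition lie_algebra :: "(complex ^ 'd) set \<Rightarrow> (real ^ 'd) set" where
  "lie_algebra M = {v. \<forall>s::real. torus_exp (s *\<^sub>R v) \<in> M}"


subsection \<open>Lattices\<close>

definition int_lattice :: "(real ^ 'd) set" where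
  "int_lattice = {v. \<forall>i. v $ i \<in> \<int>}"

definition primitive_in :: "'n::real_vector set \<Rightarrow> 'n \<Rightarrow> bool" where
  "primitive_in L v \<longleftrightarrow> v \<in> L \<and> v \<noteq> 0
     \<and> (\<forall>v'\<in>L. \<forall>k::int. v = of_int k *\<^sub>R v' \<longrightarrow> \<bar>k\<bar> = 1)"

definition int_basis :: "'n::real_vector set \<Rightarrow> 'n set \<Rightarrow> bool" where
  "int_basis B L \<longleftrightarrow> finite B
     \<and> (\<forall>c :: 'n \<Rightarrow> int. (\<Sum>b\<in>B. of_int (c b) *\<^sub>R b) = 0 \<longrightarrow> (\<forall>b\<in>B. c b = 0))
     \<and> L = {\<Sum>b\<in>B. of_int (c b) *\<^sub>R b | c :: 'n \<Rightarrow> int. True}"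

text \<open>Here \<open>L\<close> is a lattice in \<open>\<nn>\<close> and \<open>u\<close> the family of the \<open>u\<^sub>i\<close>.\<close>

definition regular_vectors :: "'n::euclidean_space set \<Rightarrow> ('d \<Rightarrow> 'n) \<Rightarrow> bool" where
  "regular_vectors L u \<longleftrightarrow>
     (\<forall>B \<subseteq> range u. card B = DIM('n) \<and> independent B \<longrightarrow> int_basis B L)"


subsection \<open>The hyperkaehler moment map\<close>

text \<open>Throughout, \<open>\<iota>\<close> is the inclusion of \<open>\<mm>\<close> (modelled by a type \<open>'m\<close>) into
  \<open>\<tt> = \<real>\<^sup>d\<close>. The dual of a finite-dimensional space \<open>V\<close> is \<open>V \<Rightarrow>\<^sub>L \<real>\<close>, and
  the complexified dual \<open>V\<^sup>* \<otimes> \<complex>\<close> is the space \<open>V \<Rightarrow>\<^sub>L \<complex>\<close> of real-linear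
  maps into \<open>\<complex>\<close>.\<close>

definition dual_basis :: "'d \<Rightarrow> (real ^ 'd) \<Rightarrow>\<^sub>L real" where
  "dual_basis i = Blinfun (\<lambda>v. v $ i)"

definition dual_map ::
    "('a::real_normed_vector \<Rightarrow>\<^sub>L 'b::real_normed_vector) \<Rightarrow> ('b \<Rightarrow>\<^sub>L real) \<Rightarrow> ('a \<Rightarrow>\<^sub>L real)" where
  "dual_map f \<phi> = \<phi> o\<^sub>L f"

text \<open>The element \<open>c \<cdot> \<phi>\<close> of the complexified dual, that is \<open>v \<mapsto> \<phi> v * c\<close>.\<close>

definition cscale :: "complex \<Rightarrow> ('m::real_normed_vector \<Rightarrow>\<^sub>L real) \<Rightarrow> ('m \<Rightarrow>\<^sub>L complex)" where
  "cscale c \<phi> = blinfun_scaleR_left c o\<^sub>L \<phi>"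

definition moment_R ::
    "('m::real_normed_vector \<Rightarrow>\<^sub>L (real ^ 'd)) \<Rightarrow> (complex ^ 'd) \<times> (complex ^ 'd) \<Rightarrow> ('m \<Rightarrow>\<^sub>L real)" where
  "moment_R \<iota> = (\<lambda>(z, w). (1 / 2) *\<^sub>R
     (\<Sum>i\<in>UNIV. ((norm (z $ i))\<^sup>2 - (norm (w $ i))\<^sup>2) *\<^sub>R dual_map \<iota> (dual_basis i)))"

definition moment_C ::
    "('m::real_normed_vector \<Rightarrow>\<^sub>L (real ^ 'd)) \<Rightarrow> (complex ^ 'd) \<times> (complex ^ 'd) \<Rightarrow> ('m \<Rightarrow>\<^sub>L complex)" where
  "moment_C \<iota> = (\<lambda>(z, w). \<Sum>i\<in>UNIV. cscale (z $ i * w $ i) (dual_map \<iota> (dual_basis i)))"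

definition moment ::
    "('m::real_normed_vector \<Rightarrow>\<^sub>L (real ^ 'd)) \<Rightarrow> (complex ^ 'd) \<times> (complex ^ 'd)
      \<Rightarrow> ('m \<Rightarrow>\<^sub>L real) \<times> ('m \<Rightarrow>\<^sub>L complex)" where
  "moment \<iota> p = (moment_R \<iota> p, moment_C \<iota> p)"

definition regular_value ::
    "('a::real_normed_vector \<Rightarrow> 'b::real_normed_vector) \<Rightarrow> 'b \<Rightarrow> bool" where
  "regular_value f y \<longleftrightarrow> (\<forall>p. f p = y \<longrightarrow> (\<exists>D. (f has_derivative D) (at p) \<and> surj D))"


subsection \<open>Semi-stability\<close>

definition semistable ::
    "('m::real_normed_vector \<Rightarrow>\<^sub>L (real ^ 'd)) \<Rightarrow> ('m \<Rightarrow>\<^sub>L real) \<Rightarrow> (complex ^ 'd) \<times> (complex ^ 'd) \<Rightarrow> bool" where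
  "semistable \<iota> \<alpha> = (\<lambda>(z, w). \<alpha> \<in>
     {(\<Sum>i\<in>UNIV. (a i * (norm (z $ i))\<^sup>2) *\<^sub>R dual_map \<iota> (dual_basis i)) +
      (\<Sum>i\<in>UNIV. (b i * (norm (w $ i))\<^sup>2) *\<^sub>R (- dual_map \<iota> (dual_basis i)))
      | a b :: 'd \<Rightarrow> real. (\<forall>i. a i \<ge> 0) \<and> (\<forall>i. b i \<ge> 0)})"


subsection \<open>The oriented hyperplane arrangement\<close>

text \<open>The arrangement is given by the vectors \<open>u\<^sub>i\<close> and the lift \<open>l\<close> and lives in the
  dual of \<open>\<nn>\<close>.\<close>

definition is_lift ::
    "('m::real_normed_vector \<Rightarrow>\<^sub>L (real ^ 'd)) \<Rightarrow> ('m \<Rightarrow>\<^sub>L real) \<Rightarrow> real ^ 'd \<Rightarrow> bool" where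
  "is_lift \<iota> \<alpha> l \<longleftrightarrow> \<alpha> = (\<Sum>i\<in>UNIV. (l $ i) *\<^sub>R dual_map \<iota> (dual_basis i))"

definition hyp :: "('d \<Rightarrow> 'n::real_normed_vector) \<Rightarrow> real ^ 'd \<Rightarrow> 'd \<Rightarrow> ('n \<Rightarrow>\<^sub>L real) set" where
  "hyp u l i = {x. blinfun_apply x (u i) + l $ i = 0}"

definition hyp_ge :: "('d \<Rightarrow> 'n::real_normed_vector) \<Rightarrow> real ^ 'd \<Rightarrow> 'd \<Rightarrow> ('n \<Rightarrow>\<^sub>L real) set" where
  "hyp_ge u l i = {x. blinfun_apply x (u i) + l $ i \<ge> 0}"

definition hyp_le :: "('d \<Rightarrow> 'n::real_normed_vector) \<Rightarrow> real ^ 'd \<Rightarrow> 'd \<Rightarrow> ('n \<Rightarrow>\<^sub>L real) set" where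
  "hyp_le u l i = {x. blinfun_apply x (u i) + l $ i \<le> 0}"

definition F_z ::
    "('d \<Rightarrow> 'n::real_normed_vector) \<Rightarrow> real ^ 'd \<Rightarrow> complex ^ 'd \<Rightarrow> 'd \<Rightarrow> ('n \<Rightarrow>\<^sub>L real) set" where
  "F_z u l z i = (if z $ i \<noteq> 0 then hyp_ge u l i else hyp u l i)"

definition F_w ::
    "('d \<Rightarrow> 'n::real_normed_vector) \<Rightarrow> real ^ 'd \<Rightarrow> complex ^ 'd \<Rightarrow> 'd \<Rightarrow> ('n \<Rightarrow>\<^sub>L real) set" where
  "F_w u l w i = (if w $ i \<noteq> 0 then hyp_le u l i else hyp u l i)"

definition St ::
    "('d \<Rightarrow> 'n::real_normed_vector) \<Rightarrow> real ^ 'd \<Rightarrow> (complex ^ 'd) \<times> (complex ^ 'd) \<Rightarrow> ('n \<Rightarrow>\<^sub>L real) set" where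
  "St u l = (\<lambda>(z, w). \<Inter>i. F_z u l z i \<union> F_w u l w i)"

end

theory Submission
  imports Defs
begin

text \<open>Both conditions assert the existence of a vector \<open>c \<in> \<real>\<^sup>d\<close> subject to the same sign
  conditions, and differ only in how \<open>c\<close> is tied to \<open>\<alpha>\<close>.

  The semi-stability cone consists of the functionals \<open>\<Sum>i. c\<^sub>i \<iota>\<^sup>*e\<^sub>i\<^sup>*\<close> for which each \<open>c\<^sub>i\<close> lies in
  the cone spanned by \<open>\<bar>z\<^sub>i\<bar>\<^sup>2\<close> and \<open>-\<bar>w\<^sub>i\<bar>\<^sup>2\<close> in \<open>\<real>\<close>: a positive \<open>c\<^sub>i\<close> needs \<open>z\<^sub>i \<noteq> 0\<close> and a negative
  one needs \<open>w\<^sub>i \<noteq> 0\<close>. On the other side, \<open>x\<close> lies in \<open>St\<close> exactly when the numbers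
  \<open>c\<^sub>i = \<langle>u\<^sub>i, x\<rangle> + \<lambda>\<^sub>i\<close> obey this very restriction (\<open>mem_St_iff\<close>).

  Since \<open>\<alpha> = \<Sum>i. \<lambda>\<^sub>i \<iota>\<^sup>*e\<^sub>i\<^sup>*\<close>, the vectors \<open>c\<close> representing \<open>\<alpha>\<close> are those with \<open>c - \<lambda>\<close> in the kernel
  of \<open>\<iota>\<^sup>*\<close>. By exactness of the dual sequence (\<open>dual_sequence_exact\<close>) this kernel is the image of
  \<open>\<pi>\<^sup>*\<close>, whose elements have the coordinates \<open>\<langle>u\<^sub>i, x\<rangle>\<close>. Hence the representatives of \<open>\<alpha>\<close>
  are precisely the vectors \<open>\<langle>u\<^sub>i, x\<rangle> + \<lambda>\<^sub>i\<close> with \<open>x \<in> \<nn>\<^sup>*\<close>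
  (\<open>same_pullback_iff\<close>), and the two conditions coincide.\<close>

text \<open>A functional vanishing on \<open>ker \<pi>\<close> takes the same value on all preimages of a point,
  so composing it with any linear section of \<open>\<pi>\<close> gives the descended functional.\<close>

lemma dual_sequence_exact:
  fixes \<iota> :: "'a::real_normed_vector \<Rightarrow>\<^sub>L 'b::real_normed_vector"
    and \<pi> :: "'b \<Rightarrow>\<^sub>L 'c::euclidean_space"
    and \<phi> :: "'b \<Rightarrow>\<^sub>L real"
  assumes surj: "surj (blinfun_apply \<pi>)"
    and ker: "{v. blinfun_apply \<pi> v = 0} = range (blinfun_apply \<iota>)"
  shows "dual_map \<iota> \<phi> = 0 \<longleftrightarrow> (\<exists>x. \<phi> = dual_map \<pi> x)"
proof
  assume zero: "dual_map \<iota> \<phi> = 0"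
  obtain g where g: "linear g" "blinfun_apply \<pi> \<circ> g = id"
    using linear_surjective_right_inverse[OF _ surj] blinfun.bounded_linear_right
      bounded_linear.linear by blast
  define x where "x = Blinfun (\<lambda>y. blinfun_apply \<phi> (g y))"
  have "bounded_linear g"
    using g(1) by (simp add: linear_conv_bounded_linear)
  then have "bounded_linear (\<lambda>y. blinfun_apply \<phi> (g y))"
    by (rule bounded_linear_compose[OF blinfun.bounded_linear_right])
  then have x: "blinfun_apply x y = \<phi> (g y)" for y
    by (simp add: x_def bounded_linear_Blinfun_apply)
  have vanish: "\<phi> v = 0" if "\<pi> v = 0" for v
  proof -
    have "v \<in> range (blinfun_apply \<iota>)"
      using that by (simp flip: ker)
    then obtain m where "v = \<iota> m"
      by (rule rangeE)
    then show ?thesis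
      using arg_cong[OF zero, of "\<lambda>f. blinfun_apply f m"] by (simp add: dual_map_def)
  qed
  have "\<phi> v = x (\<pi> v)" for v
  proof -
    have "\<pi> (v - g (\<pi> v)) = 0"
      using fun_cong[OF g(2), of "\<pi> v"] by (simp add: blinfun.diff_right)
    then show ?thesis
      using vanish[of "v - g (\<pi> v)"] by (simp add: x blinfun.diff_right)
  qed
  then show "\<exists>x. \<phi> = dual_map \<pi> x"
    by (auto simp: dual_map_def intro!: exI[of _ x] blinfun_eqI)
next
  have "\<pi> (\<iota> m) = 0" for m
    using rangeI[of "blinfun_apply \<iota>" m] by (simp flip: ker)
  moreover assume "\<exists>x. \<phi> = dual_map \<pi> x"
  ultimately show "dual_map \<iota> \<phi> = 0"
    by (auto simp: dual_map_def intro!: blinfun_eqI)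
qed

lemma dual_basis_apply [simp]: "blinfun_apply (dual_basis i) v = v $ i"
  unfolding dual_basis_def
  by (simp add: bounded_linear_Blinfun_apply bounded_linear_vec_nth)

lemma dual_map_sum_scaleR:
  "dual_map f (\<Sum>i\<in>A. c i *\<^sub>R \<phi> i) = (\<Sum>i\<in>A. c i *\<^sub>R dual_map f (\<phi> i))"
  by (rule blinfun_eqI) (simp add: dual_map_def blinfun.sum_left blinfun.scaleR_left)

lemma sum_dual_basis_apply_axis:
  "blinfun_apply (\<Sum>i\<in>UNIV. c i *\<^sub>R dual_basis i) (axis j 1) = c j"
  by (simp add: blinfun.sum_left blinfun.scaleR_left axis_def if_distrib cong: if_cong)

lemma dual_eq_iff_axis:
  fixes \<phi> \<psi> :: "(real ^ 'd) \<Rightarrow>\<^sub>L real"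
  shows "\<phi> = \<psi> \<longleftrightarrow> (\<forall>i. \<phi> (axis i 1) = \<psi> (axis i 1))"
proof
  assume "\<forall>i. \<phi> (axis i 1) = \<psi> (axis i 1)"
  then show "\<phi> = \<psi>"
    by (intro blinfun_euclidean_eqI) (auto simp: Basis_vec_def)
qed simp

text \<open>The vectors representing a given functional on \<open>\<mm>\<close> form a coset of \<open>ker \<iota>\<^sup>* = im \<pi>\<^sup>*\<close>;
  its points are parametrised by \<open>\<nn>\<^sup>*\<close>, which is what brings the arrangement into play.\<close>

lemma same_pullback_iff:
  fixes \<iota> :: "'m::real_normed_vector \<Rightarrow>\<^sub>L (real ^ 'd)"
    and \<pi> :: "(real ^ 'd) \<Rightarrow>\<^sub>L 'n::euclidean_space"
    and c l :: "'d \<Rightarrow> real"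
  assumes "surj (blinfun_apply \<pi>)"
    and "{v. blinfun_apply \<pi> v = 0} = range (blinfun_apply \<iota>)"
  shows "(\<Sum>i\<in>UNIV. l i *\<^sub>R dual_map \<iota> (dual_basis i))
           = (\<Sum>i\<in>UNIV. c i *\<^sub>R dual_map \<iota> (dual_basis i))
         \<longleftrightarrow> (\<exists>x. \<forall>i. c i = blinfun_apply x (\<pi> (axis i 1)) + l i)"
    (is "?L = ?C \<longleftrightarrow> _")
proof -
  have "?L = ?C \<longleftrightarrow> dual_map \<iota> (\<Sum>i\<in>UNIV. (c i - l i) *\<^sub>R dual_basis i) = 0"
    by (subst dual_map_sum_scaleR) (auto simp: scaleR_diff_left sum_subtractf)
  also have "\<dots> \<longleftrightarrow> (\<exists>x. (\<Sum>i\<in>UNIV. (c i - l i) *\<^sub>R dual_basis i) = dual_map \<pi> x)"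
    by (rule dual_sequence_exact[OF assms])
  also have "\<dots> \<longleftrightarrow> (\<exists>x. \<forall>i. c i = blinfun_apply x (\<pi> (axis i 1)) + l i)"
    by (simp add: dual_eq_iff_axis sum_dual_basis_apply_axis dual_map_def diff_eq_eq)
  finally show ?thesis .
qed

lemma signed_cone_iff:
  fixes p q t :: real
  assumes "p \<ge> 0" "q \<ge> 0"
  shows "(\<exists>a\<ge>0. \<exists>b\<ge>0. t = a * p - b * q) \<longleftrightarrow> (t > 0 \<longrightarrow> p \<noteq> 0) \<and> (t < 0 \<longrightarrow> q \<noteq> 0)"
proof
  assume "\<exists>a\<ge>0. \<exists>b\<ge>0. t = a * p - b * q"
  then obtain a b where ab: "a \<ge> 0" "b \<ge> 0" "t = a * p - b * q"
    by blast
  then have "a * p \<ge> 0" "b * q \<ge> 0"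
    using assms by auto
  then show "(t > 0 \<longrightarrow> p \<noteq> 0) \<and> (t < 0 \<longrightarrow> q \<noteq> 0)"
    using ab(3) by auto
next
  assume *: "(t > 0 \<longrightarrow> p \<noteq> 0) \<and> (t < 0 \<longrightarrow> q \<noteq> 0)"
  (* The positive and negative parts of t; where the divisor vanishes, so does the corresponding
     part, and division by 0 yields 0. *)
  have "t = (max t 0 / p) * p - (max (- t) 0 / q) * q"
    using * by (cases "t > 0"; cases "t < 0") auto
  moreover have "max t 0 / p \<ge> 0" "max (- t) 0 / q \<ge> 0"
    using assms by auto
  ultimately show "\<exists>a\<ge>0. \<exists>b\<ge>0. t = a * p - b * q"
    by blast
qed

text \<open>The generators for \<open>z\<^sub>i\<close> and for \<open>w\<^sub>i\<close> are opposite multiples of the same covector, so only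
  the net coefficient \<open>a\<^sub>i\<bar>z\<^sub>i\<bar>\<^sup>2 - b\<^sub>i\<bar>w\<^sub>i\<bar>\<^sup>2\<close> matters, and the indices can be treated one at
  a time.\<close>

lemma semistable_iff:
  "semistable \<iota> \<alpha> (z, w) \<longleftrightarrow>
     (\<exists>c. \<alpha> = (\<Sum>i\<in>UNIV. c i *\<^sub>R dual_map \<iota> (dual_basis i))
        \<and> (\<forall>i. (c i > 0 \<longrightarrow> z $ i \<noteq> 0) \<and> (c i < 0 \<longrightarrow> w $ i \<noteq> 0)))"
proof -
  let ?e = "\<lambda>i. dual_map \<iota> (dual_basis i)"
  let ?p = "\<lambda>i. (norm (z $ i))\<^sup>2" and ?q = "\<lambda>i. (norm (w $ i))\<^sup>2"
  have merge: "(\<Sum>i\<in>UNIV. (a i * ?p i) *\<^sub>R ?e i) + (\<Sum>i\<in>UNIV. (b i * ?q i) *\<^sub>R (- ?e i))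
      = (\<Sum>i\<in>UNIV. (a i * ?p i - b i * ?q i) *\<^sub>R ?e i)" for a b
    by (simp add: scaleR_diff_left sum_subtractf sum_negf)
  have cone: "(\<exists>a\<ge>0. \<exists>b\<ge>0. t = a * ?p i - b * ?q i)
      \<longleftrightarrow> (t > 0 \<longrightarrow> z $ i \<noteq> 0) \<and> (t < 0 \<longrightarrow> w $ i \<noteq> 0)" for t i
    by (subst signed_cone_iff) auto
  have "semistable \<iota> \<alpha> (z, w) \<longleftrightarrow> (\<exists>a b. \<alpha> = (\<Sum>i\<in>UNIV. (a i * ?p i - b i * ?q i) *\<^sub>R ?e i)
      \<and> (\<forall>i. a i \<ge> 0) \<and> (\<forall>i. b i \<ge> 0))"
    unfolding semistable_def by (simp only: merge prod.case mem_Collect_eq)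
  also have "\<dots> \<longleftrightarrow> (\<exists>c. \<alpha> = (\<Sum>i\<in>UNIV. c i *\<^sub>R ?e i)
      \<and> (\<forall>i. \<exists>a\<ge>0. \<exists>b\<ge>0. c i = a * ?p i - b * ?q i))"
    (is "?ab \<longleftrightarrow> ?c")
  proof
    assume ?ab
    then obtain a b where \<alpha>: "\<alpha> = (\<Sum>i\<in>UNIV. (a i * ?p i - b i * ?q i) *\<^sub>R ?e i)"
        and ab: "\<forall>i. a i \<ge> 0" "\<forall>i. b i \<ge> 0"
      by blast
    show ?c
      by (rule exI, rule conjI, rule \<alpha>) (use ab in blast)
  next
    assume ?c
    then obtain c where c: "\<alpha> = (\<Sum>i\<in>UNIV. c i *\<^sub>R ?e i)"
        and "\<forall>i. \<exists>a\<ge>0. \<exists>b\<ge>0. c i = a * ?p i - b * ?q i"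
      by blast
    then have "\<forall>i. \<exists>a b. a \<ge> 0 \<and> b \<ge> 0 \<and> c i = a * ?p i - b * ?q i"
      by blast
    then obtain a b where ab: "\<forall>i. a i \<ge> 0 \<and> b i \<ge> 0 \<and> c i = a i * ?p i - b i * ?q i"
      unfolding choice_iff by blast
    have "\<alpha> = (\<Sum>i\<in>UNIV. (a i * ?p i - b i * ?q i) *\<^sub>R ?e i)"
      unfolding c by (intro sum.cong) (use ab in auto)
    with ab show ?ab
      by (intro exI[of _ a] exI[of _ b]) simp
  qed
  finally show ?thesis
    by (simp only: cone)
qed

text \<open>Since \<open>H\<^sub>i\<close> lies in both half-spaces, \<open>F\<^sub>z(i) \<union> F\<^sub>w(i)\<close> always contains \<open>H\<^sub>i\<close>, and each open
  side of \<open>H\<^sub>i\<close> is added precisely when the matching coordinate is nonzero.\<close>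

lemma mem_St_iff:
  "x \<in> St u l (z, w) \<longleftrightarrow>
     (\<forall>i. (blinfun_apply x (u i) + l $ i > 0 \<longrightarrow> z $ i \<noteq> 0)
        \<and> (blinfun_apply x (u i) + l $ i < 0 \<longrightarrow> w $ i \<noteq> 0))"
proof -
  have "x \<in> F_z u l z i \<union> F_w u l w i \<longleftrightarrow>
      (blinfun_apply x (u i) + l $ i > 0 \<longrightarrow> z $ i \<noteq> 0)
      \<and> (blinfun_apply x (u i) + l $ i < 0 \<longrightarrow> w $ i \<noteq> 0)" for i
    by (auto simp: F_z_def F_w_def hyp_def hyp_ge_def hyp_le_def)
  then show ?thesis
    by (simp add: St_def)
qed

theorem proposition1p2:
  fixes M :: "(complex ^ 'd) set"
    and \<iota> :: "'m::real_normed_vector \<Rightarrow>\<^sub>L (real ^ 'd)"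
    and \<pi> :: "(real ^ 'd) \<Rightarrow>\<^sub>L 'n::euclidean_space"
    and u :: "'d \<Rightarrow> 'n"
    and \<alpha> :: "'m \<Rightarrow>\<^sub>L real" and \<beta> :: "'m \<Rightarrow>\<^sub>L complex"
    and l :: "real ^ 'd"
    and z w :: "complex ^ 'd"
  assumes "subtorus M"
    and "inj (blinfun_apply \<iota>)" and "range (blinfun_apply \<iota>) = lie_algebra M"
    and "surj (blinfun_apply \<pi>)" and "{v. blinfun_apply \<pi> v = 0} = lie_algebra M"
    and "\<And>i. u i = blinfun_apply \<pi> (axis i 1)"
    and "\<And>i. primitive_in (blinfun_apply \<pi> ` int_lattice) (u i)"
    and "regular_vectors (blinfun_apply \<pi> ` int_lattice) u"
    and "regular_value (moment \<iota>) (\<alpha>, \<beta>)"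
    and "is_lift \<iota> \<alpha> l"
    and "moment_C \<iota> (z, w) = \<beta>"
  shows "semistable \<iota> \<alpha> (z, w) \<longleftrightarrow> St u l (z, w) \<noteq> {}"
proof -
  let ?ok = "\<lambda>t i. (t > 0 \<longrightarrow> z $ i \<noteq> 0) \<and> (t < 0 \<longrightarrow> w $ i \<noteq> 0)"
  have exact: "{v. blinfun_apply \<pi> v = 0} = range (blinfun_apply \<iota>)"
    using assms(3,5) by simp
  have "semistable \<iota> \<alpha> (z, w) \<longleftrightarrow>
      (\<exists>c. (\<exists>x. \<forall>i. c i = blinfun_apply x (u i) + l $ i) \<and> (\<forall>i. ?ok (c i) i))"
    using same_pullback_iff[OF assms(4) exact, of "\<lambda>i. l $ i"] assms(10)
    by (simp add: semistable_iff is_lift_def assms(6))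
  also have "\<dots> \<longleftrightarrow> (\<exists>x. \<forall>i. ?ok (blinfun_apply x (u i) + l $ i) i)"
    (is "?L \<longleftrightarrow> ?R")
  proof
    assume ?L
    then obtain c x where c: "\<forall>i. c i = blinfun_apply x (u i) + l $ i" and "\<forall>i. ?ok (c i) i"
      by blast
    from this(2) show ?R
      unfolding c[rule_format] by blast
  next
    assume ?R
    then obtain x where "\<forall>i. ?ok (blinfun_apply x (u i) + l $ i) i"
      by blast
    then show ?L
      by (intro exI[of _ "\<lambda>i. blinfun_apply x (u i) + l $ i"] conjI exI[of _ x] allI refl) blast+
  qed
  also have "\<dots> \<longleftrightarrow> St u l (z, w) \<noteq> {}"
    unfolding mem_St_iff[symmetric] by blast
  finally show ?thesis .
qed

end
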